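(* For all integers $r \geq 2$, we have $\tilde{m}'_2(r) \leq 2^{r} + 2^{\lceil r/2 \rceil}$.
   Context: Each nonnegative integer $k$ is identified with the set $\{0,\dots,k-1\}$, and functions are identified with their graphs (so $\varphi \subseteq f$ means that $f$ extends $\varphi$). $[X \rightharpoonup k]$ denotes the set of all partial maps from $X$ to $k$, i.e. functions $\varphi$ defined on a subset $\mathrm{dom}(\varphi)$ of $X$ with values in $k$. A family $\mathcal{F} \subseteq [X \rightharpoonup k]$ is $r$-uniform if $|\mathrm{dom}(\varphi)| = r$ for all $\varphi \in \mathcal{F}$, and unary if $\mathrm{dom}(\varphi) \neq \mathrm{dom}(\psi)$ for all distinct $\varphi, \psi \in \mathcal{F}$. An $\mathcal{F}$-coloring is a (total) function $f \colon X \to k$ such that $\varphi \not\subseteq f$ for all $\varphi \in \mathcal{F}$. For $r \geq 2$, $\tilde{m}_k'(r)$ denotes the smallest cardinality of a unary $r$-uniform family $\mathcal{F} \subseteq [\mathbb{N} \rightharpoonup k]$ without an $\mathcal{F}$-coloring. *)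

theory Defs
  imports Complex_Main "HOL-Library.Extended_Nat"
begin

definition partial_maps :: "'a set \<Rightarrow> nat \<Rightarrow> ('a \<rightharpoonup> nat) set" where
  "partial_maps X k = {\<phi>. dom \<phi> \<subseteq> X \<and> ran \<phi> \<subseteq> {..<k}}"

definition uniform_family :: "nat \<Rightarrow> ('a \<rightharpoonup> nat) set \<Rightarrow> bool" where
  "uniform_family r F \<longleftrightarrow> (\<forall>\<phi>\<in>F. finite (dom \<phi>) \<and> card (dom \<phi>) = r)"

definition unary_family :: "('a \<rightharpoonup> nat) set \<Rightarrow> bool" where
  "unary_family F \<longleftrightarrow> (\<forall>\<phi>\<in>F. \<forall>\<psi>\<in>F. \<phi> \<noteq> \<psi> \<longrightarrow> dom \<phi> \<noteq> dom \<psi>)"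

(* A total function X -> k is a partial map whose domain is exactly X;
   map_le is inclusion of graphs. *)
definition family_coloring :: "'a set \<Rightarrow> nat \<Rightarrow> ('a \<rightharpoonup> nat) set \<Rightarrow> ('a \<rightharpoonup> nat) \<Rightarrow> bool" where
  "family_coloring X k F f \<longleftrightarrow>
     f \<in> partial_maps X k \<and> dom f = X \<and> (\<forall>\<phi>\<in>F. \<not> \<phi> \<subseteq>\<^sub>m f)"

(* card is 0 on infinite sets, so cardinalities are taken in enat. Collapsing all infinite
   cardinalities to \<infinity> is harmless here: a set of partial maps from nat to nat with finite
   domains is countable. *)
definition enat_card :: "'b set \<Rightarrow> enat" where
  "enat_card A = (if finite A then enat (card A) else \<infinity>)"

(* The infimum in enat of a nonempty set is its least element; it is \<infinity> if there is no
   family of the required kind. *)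
definition m_tilde' :: "nat \<Rightarrow> nat \<Rightarrow> enat" where
  "m_tilde' k r = (INF F \<in> {F. F \<subseteq> partial_maps (UNIV :: nat set) k \<and> uniform_family r F \<and>
       unary_family F \<and> \<not> (\<exists>f. family_coloring (UNIV :: nat set) k F f)}. enat_card F)"

end

theory Submission
  imports Defs
begin

text \<open>
  A unary uniform family without a coloring is an unsatisfiable formula in conjunctive normal form
  whose clauses have pairwise distinct sets of variables; a partial map is the assignment that its
  clause forbids. Take \<open>r\<close> pairs of Boolean variables \<open>y\<^sub>i, z\<^sub>i\<close>, coded as \<open>2 * i\<close> and \<open>2 * i + 1\<close>.

  Two families of clauses are used. In the first, each \<open>S \<subseteq> {0..<r}\<close> selects one
  variable from every pair (\<open>z\<^sub>i\<close> if \<open>i \<in> S\<close>, else \<open>y\<^sub>i\<close>) and forbids that every selected variable says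
  correctly whether \<open>S\<close> flips between the positions \<open>i\<close> and \<open>i + 1\<close>, read cyclically. Reading the
  assignment as instructions for a two-state walk around a cycle of length \<open>r\<close>, such an \<open>S\<close> is a walk
  that closes up. A closed walk fails to exist only if the composition of the \<open>r\<close> step maps on the
  two states is the negation, so that every step is a bijection, that is \<open>y\<^sub>i = z\<^sub>i\<close>, and an odd number
  of steps swap the states (lemma \<open>closed_walk_or_odd_flips\<close>). Hence the \<open>2 ^ r\<close> clauses leave only the
  assignments in which \<open>y\<close> and \<open>z\<close> are the same bit vector and this vector has odd weight.

  For these assignments, fixing both variables of a pair costs two variables and decides one bit.
  The same walk argument, now on a cycle of length \<open>\<lceil>r / 2\<rceil>\<close> whose step \<open>j\<close> reads bit \<open>2 * j\<close> or bit
  \<open>2 * j + 1\<close>, gives \<open>2 ^ \<lceil>r / 2\<rceil>\<close> clauses that again have \<open>r\<close> variables each. What they leave has equal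
  bits at \<open>2 * j\<close> and \<open>2 * j + 1\<close>, so for even \<open>r\<close> the weight is even, against the first family. For odd
  \<open>r\<close> one last bit is unpaired; the last step reads it through \<open>y\<close> in one state and through the
  negation of \<open>z\<close> in the other, and since \<open>y = z\<close> this step is never a bijection
  (lemma \<open>no_coloring\<close>).

  The choices made by \<open>S\<close>, and those made in the second family, can be read off from the variables of
  a clause, and only clauses of the second family contain both variables of a pair; so all sets of
  variables are distinct.
\<close>

section \<open>Clauses\<close>

definition clause :: "nat set \<Rightarrow> (nat \<Rightarrow> bool) \<Rightarrow> (nat \<rightharpoonup> nat)" where
  "clause D P = (\<lambda>x. if x \<in> D then Some (of_bool (P x)) else None)"

lemma dom_clause [simp]: "dom (clause D P) = D"
  by (auto simp: clause_def split: if_splits)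

lemma clause_in_partial_maps: "clause D P \<in> partial_maps UNIV 2"
  by (auto simp: partial_maps_def ran_def clause_def split: if_splits)

lemma clause_map_le:
  assumes "\<And>x. f x = Some (of_bool (F x))" and "\<And>x. x \<in> D \<Longrightarrow> P x = F x"
  shows "clause D P \<subseteq>\<^sub>m f"
  unfolding map_le_def dom_clause using assms by (simp add: clause_def)

section \<open>Walks on two states around a cycle\<close>

definition flips :: "nat \<Rightarrow> nat set \<Rightarrow> nat \<Rightarrow> bool" where
  "flips a S i \<longleftrightarrow> (i \<in> S) \<noteq> (Suc i mod a \<in> S)"

text \<open>
  A walk visits the positions \<open>0, \<dots>, a\<close> in one of two states; at position \<open>i\<close> in state \<open>b\<close> the
  instruction \<open>w i b\<close> tells it whether to change the state. A set \<open>S\<close> obeying all instructions is the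
  set of positions visited in state \<open>True\<close> by a walk that returns to its initial state. If neither
  initial state is returned to, the two walks end in different states; they can never have met,
  so both are swapped or both kept at each position, and the total number of swaps is odd.
\<close>

lemma closed_walk_or_odd_flips:
  fixes w :: "nat \<Rightarrow> bool \<Rightarrow> bool"
  assumes "a > 0" and no_walk: "\<And>S. S \<subseteq> {..<a} \<Longrightarrow> \<exists>i<a. w i (i \<in> S) \<noteq> flips a S i"
  shows "(\<forall>i<a. w i True = w i False) \<and> odd (card {i. i < a \<and> w i False})"
proof -
  define s where "s b = rec_nat b (\<lambda>i c. c \<noteq> w i c)" for b :: bool
  have s0 [simp]: "s b 0 = b" and sS [simp]: "s b (Suc i) = (s b i \<noteq> w i (s b i))" for b i
    by (auto simp: s_def)
  have turn: "s b a \<noteq> b" for b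
  proof
    assume closed: "s b a = b"
    have "{i. i < a \<and> s b i} \<subseteq> {..<a}" by auto
    from no_walk[OF this] obtain i where "i < a"
      and i: "w i (i \<in> {i. i < a \<and> s b i}) \<noteq> flips a {i. i < a \<and> s b i} i"
      by blast
    have "s b (Suc i mod a) = s b (Suc i)"
      using closed \<open>i < a\<close> by (cases "Suc i = a") auto
    then show False
      using i \<open>i < a\<close> by (auto simp: flips_def)
  qed
  \<comment> \<open>Walks that meet stay together, so the induction runs downwards from position \<open>a\<close>.\<close>
  have apart: "s True n \<noteq> s False n" if "n \<le> a" for n
    using that
  proof (induction n rule: inc_induct)
    case base
    show ?case using turn[of True] turn[of False] by simp
  qed auto
  have bij: "w i True = w i False" if "i < a" for i
    using apart[of i] apart[of "Suc i"] that by (cases "s True i"; cases "s False i") auto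
  have "s False n = odd (card {i. i < n \<and> w i False})" if "n \<le> a" for n
    using that
  proof (induction n)
    case (Suc n)
    have "{i. i < Suc n \<and> w i False} = (if w n False then insert n else id) {i. i < n \<and> w i False}"
      by (auto simp: less_Suc_eq)
    moreover have "w n (s False n) = w n False"
      using bij[of n] Suc.prems by (cases "s False n") auto
    ultimately show ?case
      using Suc by auto
  qed simp
  from this[of a] turn[of False] bij show ?thesis by auto
qed

section \<open>Sets of variables\<close>

definition transversal :: "nat \<Rightarrow> nat set \<Rightarrow> nat set" where
  "transversal r S = {x. x div 2 < r \<and> (odd x \<longleftrightarrow> x div 2 \<in> S)}"

text \<open>
  Variable \<open>x\<close> belongs to the pair with index \<open>x div 2\<close>, and \<open>x div 4 = j\<close> collects the variables of the
  pairs \<open>2 * j\<close> and \<open>2 * j + 1\<close>. Of these two pairs the set contains exactly one, and contains it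
  completely. If \<open>r\<close> is odd, the last pair has no partner; then the set contains one variable of it,
  which brings the size to \<open>r\<close> in this case as well.
\<close>

definition twin_transversal :: "nat \<Rightarrow> nat set \<Rightarrow> nat set" where
  "twin_transversal r T = {x. x div 2 < r \<and>
     (if 2 * (x div 4) + 1 < r then odd (x div 2) \<longleftrightarrow> x div 4 \<in> T else odd x \<longleftrightarrow> x div 4 \<in> T)}"

lemma card_transversal: "finite (transversal r S) \<and> card (transversal r S) = r"
proof -
  have "bij_betw (\<lambda>i. 2 * i + of_bool (i \<in> S)) {..<r} (transversal r S)"
    by (rule bij_betw_byWitness[where f' = "\<lambda>x. x div 2"])
      (auto simp: transversal_def)
  then show ?thesis
    using bij_betw_finite bij_betw_same_card by fastforce
qed

text \<open>
  The bijection lists both variables of the pair chosen for \<open>j\<close> at the positions \<open>2 * j\<close> and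
  \<open>2 * j + 1\<close>. A last pair without a partner occurs only for \<open>r = 2 * j + 1\<close>; its one chosen variable
  fills the last position.
\<close>

lemma card_twin_transversal: "finite (twin_transversal r T) \<and> card (twin_transversal r T) = r"
proof -
  let ?b = "\<lambda>j. of_bool (j \<in> T) :: nat"
  let ?e = "\<lambda>k. if 2 * (k div 2) + 1 < r then 4 * (k div 2) + 2 * ?b (k div 2) + k mod 2
              else 4 * (k div 2) + ?b (k div 2)"
  let ?e' = "\<lambda>x. if 2 * (x div 4) + 1 < r then 2 * (x div 4) + x mod 2 else 2 * (x div 4)"
  have [simp]: "Suc (4 * j) div 4 = j" "Suc (Suc (4 * j)) div 4 = j"
    "Suc (Suc (Suc (4 * j))) div 4 = j" "4 * j div 2 = 2 * j" "Suc (4 * j) mod 2 = Suc 0" for j :: nat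
    by presburger+
  have index: "\<exists>j. k = 2 * j \<or> k = 2 * j + 1" for k :: nat
    by presburger
  have "bij_betw ?e {..<r} (twin_transversal r T)"
  proof (rule bij_betw_byWitness[where f' = ?e'])
    show "\<forall>k\<in>{..<r}. ?e' (?e k) = k"
    proof
      fix k assume "k \<in> {..<r}"
      moreover obtain j where "k = 2 * j \<or> k = 2 * j + 1" using index by blast
      ultimately show "?e' (?e k) = k"
        by (elim disjE) (auto split: if_splits)
    qed
    show "?e ` {..<r} \<subseteq> twin_transversal r T"
    proof (rule image_subsetI)
      fix k assume "k \<in> {..<r}"
      moreover obtain j where "k = 2 * j \<or> k = 2 * j + 1" using index by blast
      ultimately show "?e k \<in> twin_transversal r T"
        by (cases "j \<in> T"; elim disjE) (auto simp: twin_transversal_def)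
    qed
    show "\<forall>x\<in>twin_transversal r T. ?e (?e' x) = x"
    proof
      fix x assume x: "x \<in> twin_transversal r T"
      define j where "j = x div 4"
      have mod: "x mod 2 = of_bool (odd x)" by (simp add: mod2_eq_if)
      have "x div 2 = 2 * j + of_bool (odd (x div 2))"
        unfolding j_def by (cases "odd (x div 2)"; simp; presburger)
      then have bits: "x = 4 * j + 2 * of_bool (odd (x div 2)) + of_bool (odd x)"
        using mod mult_div_mod_eq[of 2 x] by linarith
      have index_of_bits: "(2 * j + of_bool (odd x)) div 2 = j" by simp
      show "?e (?e' x) = x"
      proof (cases "2 * j + 1 < r")
        case True
        then have "odd (x div 2) \<longleftrightarrow> j \<in> T"
          using x by (simp add: twin_transversal_def j_def)
        moreover have "?e' x = 2 * j + of_bool (odd x)"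
          using True by (simp add: j_def mod)
        ultimately show ?thesis
          using True bits index_of_bits by simp
      next
        case False
        then have "odd x \<longleftrightarrow> j \<in> T" and "x div 2 < r"
          using x by (simp_all add: twin_transversal_def j_def)
        moreover have "x div 2 = 2 * j"
          using False \<open>x div 2 < r\<close> unfolding j_def by linarith
        moreover have "?e' x = 2 * j"
          using False by (simp add: j_def)
        ultimately show ?thesis
          using False bits by simp
      qed
    qed
    show "?e' ` twin_transversal r T \<subseteq> {..<r}"
    proof (rule image_subsetI)
      fix x assume "x \<in> twin_transversal r T"
      then have "2 * (x div 4) < r" unfolding twin_transversal_def by simp linarith
      then show "?e' x \<in> {..<r}"
        by (cases "even x") (auto simp: mod2_eq_if)
    qed
  qed
  then show ?thesis
    using bij_betw_finite bij_betw_same_card by fastforce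
qed

lemma inj_on_transversal: "inj_on (transversal r) (Pow {..<r})"
proof (rule inj_onI)
  fix S S' assume sub: "S \<in> Pow {..<r}" "S' \<in> Pow {..<r}"
    and eq: "transversal r S = transversal r S'"
  have mem: "2 * i + 1 \<in> transversal r A \<longleftrightarrow> i \<in> A" if "i < r" for i A
    using that by (simp add: transversal_def)
  have "i \<in> S \<longleftrightarrow> i \<in> S'" if "i < r" for i
    using mem[OF that] eq by blast
  then show "S = S'" using sub by auto
qed

lemma inj_on_twin_transversal: "inj_on (twin_transversal r) (Pow {..<(r + 1) div 2})"
proof (rule inj_onI)
  fix T T' assume sub: "T \<in> Pow {..<(r + 1) div 2}" "T' \<in> Pow {..<(r + 1) div 2}"
    and eq: "twin_transversal r T = twin_transversal r T'"
  have mem: "(if 2 * j + 1 < r then 4 * j + 2 else 4 * j + 1) \<in> twin_transversal r A \<longleftrightarrow> j \<in> A"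
    if "j < (r + 1) div 2" for j A
  proof -
    have [simp]: "Suc (Suc (4 * j)) div 4 = j" "Suc (4 * j) div 4 = j"
      by auto
    show ?thesis using that by (auto simp: twin_transversal_def)
  qed
  have "j \<in> T \<longleftrightarrow> j \<in> T'" if "j < (r + 1) div 2" for j
    using mem[OF that] eq by blast
  then show "T = T'" using sub by auto
qed

text \<open>
  For \<open>r \<ge> 2\<close> one of the first two pairs is contained in \<open>twin_transversal r T\<close>, whereas a
  transversal meets every pair in one variable.
\<close>

lemma transversal_neq_twin_transversal:
  assumes "r \<ge> 2"
  shows "transversal r S \<noteq> twin_transversal r T"
proof
  assume eq: "transversal r S = twin_transversal r T"
  define i :: nat where "i = of_bool (0 \<in> T)"
  have "2 * i \<in> twin_transversal r T" "2 * i + 1 \<in> twin_transversal r T"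
    using assms by (auto simp: twin_transversal_def i_def)
  with eq have "2 * i \<in> transversal r S" "2 * i + 1 \<in> transversal r S"
    by simp_all
  then show False
    by (auto simp: transversal_def)
qed

section \<open>The two families\<close>

definition cyclic_clauses :: "nat \<Rightarrow> (nat \<rightharpoonup> nat) set" where
  "cyclic_clauses r = (\<lambda>S. clause (transversal r S) (\<lambda>x. flips r S (x div 2))) ` Pow {..<r}"

text \<open>
  The right-hand side of the inequation is the negation with which an unpaired last bit is read
  through the odd variable of its pair.
\<close>

definition twin_clauses :: "nat \<Rightarrow> (nat \<rightharpoonup> nat) set" where
  "twin_clauses r = (\<lambda>T. clause (twin_transversal r T)
     (\<lambda>x. flips ((r + 1) div 2) T (x div 4) \<noteq> (2 * (x div 4) + 1 \<ge> r \<and> odd x)))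
     ` Pow {..<(r + 1) div 2}"

lemma even_card_paired:
  fixes P :: "nat \<Rightarrow> bool"
  assumes "\<And>j. j < t \<Longrightarrow> P (2 * j + 1) = P (2 * j)"
  shows "even (card {i. i < 2 * t \<and> P i})"
  using assms
proof (induction t)
  case (Suc t)
  have "{i. i < 2 * Suc t \<and> P i}
      = (if P (2 * t) then {2 * t, 2 * t + 1} else {}) \<union> {i. i < 2 * t \<and> P i}"
    using Suc.prems[of t] by (auto simp: less_Suc_eq)
  moreover have "card ({2 * t, 2 * t + 1} \<union> {i. i < 2 * t \<and> P i}) = 2 + card {i. i < 2 * t \<and> P i}"
    by (subst card_Un_disjoint) auto
  ultimately show ?case
    using Suc by auto
qed simp

lemma no_coloring:
  assumes "r \<ge> 2"
  shows "\<not> (\<exists>f. family_coloring UNIV 2 (cyclic_clauses r \<union> twin_clauses r) f)"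
proof
  assume "\<exists>f. family_coloring UNIV 2 (cyclic_clauses r \<union> twin_clauses r) f"
  then obtain f where "ran f \<subseteq> {..<2}" "dom f = UNIV"
    and avoid: "\<And>\<phi>. \<phi> \<in> cyclic_clauses r \<union> twin_clauses r \<Longrightarrow> \<not> \<phi> \<subseteq>\<^sub>m f"
    by (auto simp: family_coloring_def partial_maps_def)
  define F where "F x \<longleftrightarrow> f x = Some 1" for x
  have f: "f x = Some (of_bool (F x))" for x
  proof -
    obtain v where v: "f x = Some v" using \<open>dom f = UNIV\<close> by auto
    then have "v < 2" using \<open>ran f \<subseteq> {..<2}\<close> by (auto simp: ran_def)
    then show ?thesis using v by (auto simp: F_def)
  qed
  define h where "h = (r + 1) div 2"
  \<comment> \<open>Avoiding the first family means that the first system of instructions has no closed walk.\<close>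
  have "\<exists>i<r. F (2 * i + of_bool (i \<in> S)) \<noteq> flips r S i" if S: "S \<subseteq> {..<r}" for S
  proof (rule ccontr)
    assume no: "\<not> (\<exists>i<r. F (2 * i + of_bool (i \<in> S)) \<noteq> flips r S i)"
    have "clause (transversal r S) (\<lambda>x. flips r S (x div 2)) \<subseteq>\<^sub>m f"
    proof (rule clause_map_le[OF f])
      fix x assume x: "x \<in> transversal r S"
      then have "x div 2 < r" and "2 * (x div 2) + of_bool (x div 2 \<in> S) = x"
        by (auto simp: transversal_def)
      then show "flips r S (x div 2) = F x"
        using no by metis
    qed
    then show False
      using avoid S by (auto simp: cyclic_clauses_def)
  qed
  from closed_walk_or_odd_flips[of r "\<lambda>i b. F (2 * i + of_bool b)", OF _ this] assms
  have twins: "\<And>i. i < r \<Longrightarrow> F (2 * i + 1) = F (2 * i)"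
    and odd: "odd (card {i. i < r \<and> F (2 * i)})" by auto
  \<comment> \<open>The instructions of the second walk: state \<open>b\<close> selects which bit is read, or, at an unpaired last
     bit, which of its two variables is read.\<close>
  define w where "w j b \<longleftrightarrow> (if 2 * j + 1 < r then F (2 * (2 * j + of_bool b))
      else F (4 * j + of_bool b) \<noteq> b)" for j b
  have "\<exists>j<h. w j (j \<in> T) \<noteq> flips h T j" if T: "T \<subseteq> {..<h}" for T
  proof (rule ccontr)
    assume no: "\<not> (\<exists>j<h. w j (j \<in> T) \<noteq> flips h T j)"
    have "clause (twin_transversal r T)
        (\<lambda>x. flips h T (x div 4) \<noteq> (2 * (x div 4) + 1 \<ge> r \<and> odd x)) \<subseteq>\<^sub>m f"
    proof (rule clause_map_le[OF f])
      fix x assume x: "x \<in> twin_transversal r T"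
      let ?j = "x div 4"
      have lt: "x div 2 < r" using x by (simp add: twin_transversal_def)
      then have "?j < h" unfolding h_def by linarith
      then have *: "flips h T ?j = w ?j (?j \<in> T)" using no by blast
      show "(flips h T ?j \<noteq> (2 * ?j + 1 \<ge> r \<and> odd x)) = F x"
      proof (cases "2 * ?j + 1 < r")
        case True
        have "odd (x div 2) \<longleftrightarrow> ?j \<in> T"
          using x True by (simp add: twin_transversal_def)
        then have "x div 2 = 2 * ?j + of_bool (?j \<in> T)"
          by (cases "?j \<in> T"; simp; presburger)
        moreover have "F x = F (2 * (x div 2))"
          using twins[OF lt] by (cases "even x") auto
        ultimately show ?thesis
          using True * by (simp add: w_def)
      next
        case False
        have "odd x \<longleftrightarrow> ?j \<in> T"
          using x False by (simp add: twin_transversal_def)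
        moreover have "x div 2 = 2 * ?j"
          using False lt by linarith
        ultimately have "x = 4 * ?j + of_bool (?j \<in> T)"
          by (cases "?j \<in> T"; simp; presburger)
        then show ?thesis
          using False * \<open>odd x \<longleftrightarrow> ?j \<in> T\<close> by (auto simp: w_def)
      qed
    qed
    then show False
      using avoid T by (auto simp: twin_clauses_def h_def)
  qed
  from closed_walk_or_odd_flips[of h w, OF _ this] assms
  have w: "w j True = w j False" if "j < h" for j
    using that by (auto simp: h_def)
  \<comment> \<open>Even \<open>r\<close>: the bits agree in twos, which contradicts odd weight. Odd \<open>r\<close>: at the unpaired bit
     the two instructions are a value and its negation.\<close>
  show False
  proof (cases "even r")
    case True
    then obtain t where t: "r = 2 * t" by auto
    have "even (card {i. i < 2 * t \<and> F (2 * i)})"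
    proof (rule even_card_paired)
      fix j assume "j < t"
      then show "F (2 * (2 * j + 1)) = F (2 * (2 * j))"
        using w[of j] t by (simp add: w_def h_def)
    qed
    then show False using odd t by simp
  next
    case False
    then obtain t where t: "r = 2 * t + 1" by (auto elim: oddE)
    then show False
      using w[of t] twins[of "2 * t"] by (auto simp: w_def h_def)
  qed
qed

lemma unary_cyclic_twin_clauses:
  assumes "r \<ge> 2"
  shows "unary_family (cyclic_clauses r \<union> twin_clauses r)"
  unfolding unary_family_def
proof (intro ballI impI notI)
  fix \<phi> \<psi>
  assume mem: "\<phi> \<in> cyclic_clauses r \<union> twin_clauses r" "\<psi> \<in> cyclic_clauses r \<union> twin_clauses r"
    and "\<phi> \<noteq> \<psi>" and "dom \<phi> = dom \<psi>"
  note neq = transversal_neq_twin_transversal[OF assms]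
  from mem consider
      "\<phi> \<in> cyclic_clauses r" "\<psi> \<in> cyclic_clauses r"
    | "\<phi> \<in> twin_clauses r" "\<psi> \<in> twin_clauses r"
    | "\<phi> \<in> cyclic_clauses r" "\<psi> \<in> twin_clauses r"
    | "\<phi> \<in> twin_clauses r" "\<psi> \<in> cyclic_clauses r"
    by blast
  then show False
  proof cases
    case 1
    then obtain S S' where "S \<in> Pow {..<r}" "S' \<in> Pow {..<r}"
      and "\<phi> = clause (transversal r S) (\<lambda>x. flips r S (x div 2))"
      and "\<psi> = clause (transversal r S') (\<lambda>x. flips r S' (x div 2))"
      unfolding cyclic_clauses_def by blast
    then show False
      using inj_on_transversal \<open>\<phi> \<noteq> \<psi>\<close> \<open>dom \<phi> = dom \<psi>\<close> by (metis dom_clause inj_onD)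
  next
    case 2
    then show False
      using inj_onD[OF inj_on_twin_transversal[of r]] \<open>\<phi> \<noteq> \<psi>\<close> \<open>dom \<phi> = dom \<psi>\<close>
      unfolding twin_clauses_def by (elim imageE) auto
  next
    case 3
    then show False
      using neq \<open>dom \<phi> = dom \<psi>\<close> by (auto simp: cyclic_clauses_def twin_clauses_def)
  next
    case 4
    then show False
      using neq[symmetric] \<open>dom \<phi> = dom \<psi>\<close> by (auto simp: cyclic_clauses_def twin_clauses_def)
  qed
qed

theorem theorem1p24:
  fixes r :: nat
  assumes "r \<ge> 2"
  shows "m_tilde' 2 r \<le> enat (2 ^ r + 2 ^ nat \<lceil>real r / 2\<rceil>)"
proof -
  let ?F = "cyclic_clauses r \<union> twin_clauses r"
  have half: "nat \<lceil>real r / 2\<rceil> = (r + 1) div 2"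
    by linarith
  have "uniform_family r ?F"
    using card_transversal card_twin_transversal
    by (auto simp: uniform_family_def cyclic_clauses_def twin_clauses_def)
  moreover have "?F \<subseteq> partial_maps UNIV 2"
    by (auto simp: cyclic_clauses_def twin_clauses_def clause_in_partial_maps)
  ultimately have "m_tilde' 2 r \<le> enat_card ?F"
    unfolding m_tilde'_def
    using unary_cyclic_twin_clauses no_coloring assms by (intro INF_lower) simp
  also have "\<dots> = enat (card ?F)"
    by (simp add: enat_card_def cyclic_clauses_def twin_clauses_def)
  also have "card ?F \<le> 2 ^ r + 2 ^ ((r + 1) div 2)"
  proof -
    have "card (cyclic_clauses r) \<le> 2 ^ r"
      unfolding cyclic_clauses_def
      by (rule order_trans[OF card_image_le]) (auto simp: card_Pow)
    moreover have "card (twin_clauses r) \<le> 2 ^ ((r + 1) div 2)"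
      unfolding twin_clauses_def
      by (rule order_trans[OF card_image_le]) (auto simp: card_Pow)
    ultimately show ?thesis
      using card_Un_le[of "cyclic_clauses r" "twin_clauses r"] by linarith
  qed
  finally show ?thesis
    by (simp add: half)
qed

end
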